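(* $[\mathbf{Txt}\mathbf{Td}\mathbf{Ex}_C]_{\mathbf{REC}} = [\mathbf{Txt}\mathbf{Td}\mathbf{Bc}_C]_{\mathbf{REC}}$.
   Context: Fix an acceptable numbering $(\varphi_e)_{e\in\mathbb{N}}$ of all partial computable functions. A number $e$ is a $C$-index if $\varphi_e$ is total with values in $\{0,1\}$; then $C_e=\{x:\varphi_e(x)=1\}$. $\mathbf{REC}$ is the collection of recursive subsets of $\mathbb{N}$; $\mathcal{P}$ denotes the partial computable functions. Fix a pause symbol $\#$. A text is a total function $T:\mathbb{N}\to\mathbb{N}\cup\{\#\}$, $\mathrm{content}(T)=\mathrm{range}(T)\setminus\{\#\}$, $T$ is a text for $L$ if $\mathrm{content}(T)=L$. A learner is some $h\in\mathcal{P}$, which may output a special symbol "?" meaning "no new hypothesis". Transductive hypothesis sequence: $\mathbf{Td}(h,T)(0)=?$, and for $i>0$, $\mathbf{Td}(h,T)(i)=\mathbf{Td}(h,T)(i-1)$ if $h(T(i-1))=?$, else $h(T(i-1))$. Restrictions on hypothesis sequence $p$ and text $T$: $\mathbf{Ex}_C$: there is $n_0$ with $p(n)=p(n_0)$ for all $n\ge n_0$ and $p(n_0)$ a $C$-index with $C_{p(n_0)}=\mathrm{content}(T)$; $\mathbf{Bc}_C$: there is $n_0$ such that for all $n\ge n_0$, $p(n)$ is a $C$-index with $C_{p(n)}=\mathrm{content}(T)$. A learner $h$ $\mathbf{Txt}\mathbf{Td}\delta$-learns $L$ iff $\delta(\mathbf{Td}(h,T),T)$ holds for every text $T$ for $L$;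 $[\mathbf{Txt}\mathbf{Td}\delta]_{\mathbf{REC}}$ is the set of all classes $\mathcal{L}\subseteq\mathbf{REC}$ for which some $h\in\mathcal{P}$ learns every $L\in\mathcal{L}$. *)

theory Defs imports Main begin

text \<open>
  Kleene's partial recursive functions. Terms carry no arity: a term is applied to an argument
  list, and an application with too few (for \<open>Succ\<close>: also too many) arguments is undefined.
  For each fixed length \<open>n\<close> the terms denote exactly the partial recursive functions in \<open>n\<close> arguments.
  The recursion argument of \<open>PrimRec\<close> and the search argument of \<open>Mu\<close> come first; the step function
  of \<open>PrimRec\<close> receives counter, previous value, parameters.
\<close>

datatype rec_term =
    Zero
  | Succ
  | Proj nat
  | Comp rec_term "rec_term list"
  | PrimRec rec_term rec_term
  | Mu rec_term

definition mu_op :: "(nat \<Rightarrow> nat option) \<Rightarrow> nat option" where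
  "mu_op f =
     (if \<exists>z. f z = Some 0 \<and> (\<forall>y<z. \<exists>v. f y = Some (Suc v))
      then Some (LEAST z. f z = Some 0) else None)"

primrec prim_rec_op ::
  "nat option \<Rightarrow> (nat \<Rightarrow> nat \<Rightarrow> nat option) \<Rightarrow> nat \<Rightarrow> nat option" where
  "prim_rec_op b s 0 = b"
| "prim_rec_op b s (Suc n) = Option.bind (prim_rec_op b s n) (s n)"

fun eval :: "rec_term \<Rightarrow> nat list \<Rightarrow> nat option" where
  "eval Zero xs = Some 0"
| "eval Succ xs = (case xs of [x] \<Rightarrow> Some (Suc x) | _ \<Rightarrow> None)"
| "eval (Proj i) xs = (if i < length xs then Some (xs ! i) else None)"
| "eval (Comp f gs) xs = Option.bind (those (map (\<lambda>g. eval g xs) gs)) (eval f)"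
| "eval (PrimRec f g) xs =
     (case xs of [] \<Rightarrow> None
      | x # ys \<Rightarrow> prim_rec_op (eval f ys) (\<lambda>n v. eval g (n # v # ys)) x)"
| "eval (Mu f) xs = mu_op (\<lambda>z. eval f (z # xs))"

definition partial_computable :: "(nat \<Rightarrow> nat option) \<Rightarrow> bool" where
  "partial_computable f \<longleftrightarrow> (\<exists>r. \<forall>x. f x = eval r [x])"

definition partial_computable2 :: "(nat \<Rightarrow> nat \<Rightarrow> nat option) \<Rightarrow> bool" where
  "partial_computable2 f \<longleftrightarrow> (\<exists>r. \<forall>x y. f x y = eval r [x, y])"

definition computable :: "(nat \<Rightarrow> nat) \<Rightarrow> bool" where
  "computable f \<longleftrightarrow> partial_computable (\<lambda>x. Some (f x))"

definition acceptable_numbering :: "(nat \<Rightarrow> nat \<Rightarrow> nat option) \<Rightarrow> bool" where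
  "acceptable_numbering \<phi> \<longleftrightarrow>
     range \<phi> = {f. partial_computable f} \<and>
     partial_computable2 \<phi> \<and>
     (\<forall>\<psi>. partial_computable2 \<psi> \<longrightarrow> (\<exists>t. computable t \<and> (\<forall>e. \<psi> e = \<phi> (t e))))"

definition C_index :: "(nat \<Rightarrow> nat \<Rightarrow> nat option) \<Rightarrow> nat \<Rightarrow> bool" where
  "C_index \<phi> e \<longleftrightarrow> (\<forall>x. \<phi> e x = Some 0 \<or> \<phi> e x = Some 1)"

definition C_set :: "(nat \<Rightarrow> nat \<Rightarrow> nat option) \<Rightarrow> nat \<Rightarrow> nat set" where
  "C_set \<phi> e = {x. \<phi> e x = Some 1}"

definition REC :: "nat set set" where
  "REC = {L. computable (\<lambda>x. if x \<in> L then 1 else 0)}"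

datatype datum = Pause | Datum nat

text \<open>\<open>NoHyp\<close> is the output symbol ``?''.\<close>

datatype hyp = NoHyp | Hyp nat

definition content :: "(nat \<Rightarrow> datum) \<Rightarrow> nat set" where
  "content T = {x. Datum x \<in> range T}"

definition text_for :: "(nat \<Rightarrow> datum) \<Rightarrow> nat set \<Rightarrow> bool" where
  "text_for T L \<longleftrightarrow> content T = L"

primrec datum_code :: "datum \<Rightarrow> nat" where
  "datum_code Pause = 0"
| "datum_code (Datum x) = Suc x"

primrec hyp_code :: "hyp \<Rightarrow> nat" where
  "hyp_code NoHyp = 0"
| "hyp_code (Hyp e) = Suc e"

text \<open>
  A learner is a partial map (\<open>None\<close> means undefined, as opposed to \<open>Some NoHyp\<close>) which is partial
  computable with respect to the bijective codings above.
\<close>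

definition learner :: "(datum \<Rightarrow> hyp option) \<Rightarrow> bool" where
  "learner h \<longleftrightarrow>
     (\<exists>f. partial_computable f \<and> (\<forall>d. map_option hyp_code (h d) = f (datum_code d)))"

text \<open>The hypothesis sequence is undefined (\<open>None\<close>) wherever its defining recursion needs an
  undefined value of the learner.\<close>

primrec Td :: "(datum \<Rightarrow> hyp option) \<Rightarrow> (nat \<Rightarrow> datum) \<Rightarrow> nat \<Rightarrow> hyp option" where
  "Td h T 0 = Some NoHyp"
| "Td h T (Suc i) = (if h (T i) = Some NoHyp then Td h T i else h (T i))"

type_synonym restriction = "(nat \<Rightarrow> hyp option) \<Rightarrow> (nat \<Rightarrow> datum) \<Rightarrow> bool"

definition Ex_C :: "(nat \<Rightarrow> nat \<Rightarrow> nat option) \<Rightarrow> restriction" where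
  "Ex_C \<phi> p T \<longleftrightarrow>
     (\<exists>n0. (\<forall>n\<ge>n0. p n = p n0) \<and>
           (\<exists>e. p n0 = Some (Hyp e) \<and> C_index \<phi> e \<and> C_set \<phi> e = content T))"

definition Bc_C :: "(nat \<Rightarrow> nat \<Rightarrow> nat option) \<Rightarrow> restriction" where
  "Bc_C \<phi> p T \<longleftrightarrow>
     (\<exists>n0. \<forall>n\<ge>n0. \<exists>e. p n = Some (Hyp e) \<and> C_index \<phi> e \<and> C_set \<phi> e = content T)"

definition TxtTd_learns :: "restriction \<Rightarrow> (datum \<Rightarrow> hyp option) \<Rightarrow> nat set \<Rightarrow> bool" where
  "TxtTd_learns \<delta> h L \<longleftrightarrow> (\<forall>T. text_for T L \<longrightarrow> \<delta> (Td h T) T)"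

definition TxtTd_REC :: "restriction \<Rightarrow> nat set set set" where
  "TxtTd_REC \<delta> = {\<L>. \<L> \<subseteq> REC \<and> (\<exists>h. learner h \<and> (\<forall>L\<in>\<L>. TxtTd_learns \<delta> h L))}"

end

theory Submission imports Defs begin

text \<open>
  If \<open>h\<close> \<open>Bc\<close>-learns \<open>L\<close>, then on each datum that may occur in a text for \<open>L\<close> it is defined, and its
  value is ``?'' or a correct index: otherwise a text repeating that datum forever would be a
  counterexample. An index guessed on a single datum thus decides \<open>L\<close>, so one can search for the
  least datum of \<open>L\<close> on which \<open>h\<close> makes a guess and output that guess instead. The new guess
  depends on \<open>L\<close> only.
\<close>

text \<open>A pause may occur in a text for any \<open>L\<close>, so its code 0 is always
  included.\<close>

definition data_codes :: "nat set \<Rightarrow> nat set" where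
  "data_codes L = insert 0 (Suc ` L)"

lemma datum_code_in_data_codes:
  "datum_code d \<in> data_codes L \<longleftrightarrow> (d = Pause \<or> (\<exists>x\<in>L. d = Datum x))"
  by (cases d) (auto simp: data_codes_def)

lemma data_codes_cases:
  assumes "k \<in> data_codes L"
  obtains d where "k = datum_code d" "datum_code d \<in> data_codes L"
proof -
  have "k = datum_code (case k of 0 \<Rightarrow> Pause | Suc x \<Rightarrow> Datum x)"
    by (simp split: nat.split)
  with assms that show thesis by metis
qed

definition One_term :: rec_term where
  "One_term = Comp Succ [Zero]"

lemma eval_One_term [simp]: "eval One_term xs = Some 1"
  by (simp add: One_term_def)

definition Pred_term :: rec_term where
  "Pred_term = PrimRec Zero (Proj 0)"

lemma eval_Pred_term [simp]: "eval Pred_term [n] = Some (n - 1)"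
proof -
  have "prim_rec_op (Some 0) (\<lambda>n v. Some n) n = Some (n - 1)"
    by (induction n) auto
  then show ?thesis by (simp add: Pred_term_def)
qed

definition IsZero_term :: rec_term where
  "IsZero_term = PrimRec One_term Zero"

lemma eval_IsZero_term [simp]: "eval IsZero_term [n] = Some (if n = 0 then 1 else 0)"
proof -
  have "prim_rec_op (Some 1) (\<lambda>n v. Some 0) n = Some (if n = 0 then 1 else 0)"
    by (induction n) auto
  then show ?thesis by (simp add: IsZero_term_def)
qed

text \<open>Recursion with a constant step serves as a lazy conditional: at 0 the step is never
  consulted, and beyond 0 binding \<open>c\<close> repeatedly gives \<open>c\<close> again, even if
  it is \<open>None\<close>.\<close>

lemma prim_rec_op_const:
  "prim_rec_op (Some b) (\<lambda>_ _. c) (Suc n) = c"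
  by (cases c; induction n) simp_all

text \<open>The recursion is a case distinction on the code: 0 is the pause, and at
  \<open>Suc k\<close> the counter \<open>k\<close> is the number to be tested with index
  \<open>e\<close>.\<close>

definition Member_term :: "rec_term \<Rightarrow> rec_term" where
  "Member_term U = PrimRec One_term (Comp U [Proj 2, Proj 0])"

lemma eval_Member_term:
  assumes U: "\<And>e x. \<phi> e x = eval U [e, x]" and "C_index \<phi> e"
  shows "eval (Member_term U) [k, e] = Some (if k \<in> data_codes (C_set \<phi> e) then 1 else 0)"
\<comment> \<open>The step function ignores the previous value, but \<open>prim_rec_op\<close> binds
  it, so it has to be defined.\<close>
proof (induction k)
  case 0
  then show ?case by (simp add: Member_term_def data_codes_def)
next
  case (Suc k)
  moreover have "\<phi> e k = Some 0 \<or> \<phi> e k = Some 1"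
    using assms(2) by (simp add: C_index_def)
  ultimately show ?case
    by (auto simp: Member_term_def data_codes_def C_set_def U)
qed

text \<open>The outer recursion only serves as a conditional that does not evaluate \<open>F\<close> outside the set
  described by \<open>U\<close>, where \<open>F\<close> may be undefined.\<close>

definition Test_term :: "rec_term \<Rightarrow> rec_term \<Rightarrow> rec_term" where
  "Test_term U F =
     Comp (PrimRec One_term (Comp IsZero_term [Comp F [Proj 2]])) [Member_term U, Proj 0]"

text \<open>Output 0 of \<open>F\<close> encodes \<open>NoHyp\<close>, so the test value 0 marks a
  guess inside the set, and 1 lets \<open>Mu\<close> continue.\<close>

lemma eval_Test_term:
  assumes "\<And>e x. \<phi> e x = eval U [e, x]" and "C_index \<phi> e"
  shows "eval (Test_term U F) [k, e] =
    (if k \<in> data_codes (C_set \<phi> e) then map_option (\<lambda>v. if v = 0 then 1 else 0) (eval F [k])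
     else Some 1)"
  by (cases "eval F [k]") (simp_all add: Test_term_def eval_Member_term[OF assms])

lemma mu_op_eq:
  assumes "f m = Some 0" and "\<And>y. y < m \<Longrightarrow> f y = Some 1"
  shows "mu_op f = Some m"
proof -
  have "(LEAST z. f z = Some 0) = m"
    using assms by (intro Least_equality) (auto simp: not_less[symmetric])
  then show ?thesis
    using assms by (auto simp: mu_op_def)
qed

text \<open>\<open>F\<close> is supplied twice: as recursion argument it separates
  \<open>NoHyp\<close> from a guess, as parameter it carries the code \<open>Suc e\<close>, from
  which \<open>Pred_term\<close> recovers \<open>e\<close> for the search.\<close>

definition First_guess_term :: "rec_term \<Rightarrow> rec_term \<Rightarrow> rec_term" where
  "First_guess_term U F =
     Comp (PrimRec Zero (Comp F [Comp (Mu (Test_term U F)) [Comp Pred_term [Proj 2]]])) [F, F]"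

lemma eval_First_guess_term_0:
  "eval F [k] = Some 0 \<Longrightarrow> eval (First_guess_term U F) [k] = Some 0"
  by (simp add: First_guess_term_def)

text \<open>The search passes every code below \<open>m\<close> with test value 1. The index
  \<open>e\<close> enters only through its set, so all indices of one set lead to the same
  \<open>v\<close>.\<close>

lemma eval_First_guess_term_Suc:
  assumes U: "\<And>e x. \<phi> e x = eval U [e, x]" and "C_index \<phi> e"
    and k: "eval F [k] = Some (Suc e)"
    and m: "m \<in> data_codes (C_set \<phi> e)" "eval F [m] = Some (Suc v)"
    and least: "\<And>y. y < m \<Longrightarrow> y \<in> data_codes (C_set \<phi> e) \<Longrightarrow> eval F [y] = Some 0"
  shows "eval (First_guess_term U F) [k] = Some (Suc v)"
proof -
  have "mu_op (\<lambda>y. eval (Test_term U F) [y, e]) = Some m"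
    by (rule mu_op_eq) (auto simp: eval_Test_term[OF U assms(2)] m least)
  then show ?thesis
    by (simp add: First_guess_term_def k m prim_rec_op_const del: prim_rec_op.simps)
qed

definition hyp_decode :: "nat \<Rightarrow> hyp" where
  "hyp_decode k = (case k of 0 \<Rightarrow> NoHyp | Suc e \<Rightarrow> Hyp e)"

lemma hyp_decode_simps [simp]: "hyp_decode 0 = NoHyp" "hyp_decode (Suc e) = Hyp e"
  by (simp_all add: hyp_decode_def)

lemma hyp_decode_eq_iff [simp]:
  "hyp_decode k = NoHyp \<longleftrightarrow> k = 0" "hyp_decode k = Hyp e \<longleftrightarrow> k = Suc e"
  by (cases k; simp)+

lemma hyp_code_decode [simp]: "hyp_code (hyp_decode k) = k"
  by (cases k) simp_all

lemma hyp_decode_code [simp]: "hyp_decode (hyp_code p) = p"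
  by (cases p) simp_all

text \<open>\<open>hyp_decode\<close> inverts \<open>hyp_code\<close> on both sides. In this form
  every term yields a learner.\<close>

lemma learner_iff_rec_term:
  "learner h \<longleftrightarrow> (\<exists>F. \<forall>d. h d = map_option hyp_decode (eval F [datum_code d]))"
proof
  assume "learner h"
  then obtain F where "\<And>d. map_option hyp_code (h d) = eval F [datum_code d]"
    by (auto simp: learner_def partial_computable_def)
  then have "h d = map_option hyp_decode (eval F [datum_code d])" for d
    by (metis (no_types, lifting) hyp_decode_code option.map_comp option.map_ident
        option.map_cong comp_apply)
  then show "\<exists>F. \<forall>d. h d = map_option hyp_decode (eval F [datum_code d])" by blast
next
  assume "\<exists>F. \<forall>d. h d = map_option hyp_decode (eval F [datum_code d])"
  then obtain F where F: "\<And>d. h d = map_option hyp_decode (eval F [datum_code d])" by blast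
  have "map_option hyp_code (h d) = eval F [datum_code d]" for d
    by (cases "eval F [datum_code d]") (simp_all add: F)
  then show "learner h"
    unfolding learner_def partial_computable_def by (intro exI[of _ "\<lambda>k. eval F [k]"]) auto
qed

lemma datum_code_text_in_data_codes:
  "text_for T L \<Longrightarrow> datum_code (T i) \<in> data_codes L"
  by (cases "T i") (auto simp: text_for_def content_def data_codes_def image_iff intro: sym)

lemma Bc_C_learner_on_data:
  assumes learns: "TxtTd_learns (Bc_C \<phi>) h L" and d: "datum_code d \<in> data_codes L"
  shows "h d = Some NoHyp \<or> (\<exists>e. h d = Some (Hyp e) \<and> C_index \<phi> e \<and> C_set \<phi> e = L)"
proof -
  \<comment> \<open>Even positions repeat \<open>d\<close>, odd ones enumerate \<open>L\<close>, so
    that the content is exactly \<open>L\<close>.\<close>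
  define T where "T n = (if even n then d else if n div 2 \<in> L then Datum (n div 2) else Pause)" for n
  have "x \<in> L" if "T n = Datum x" for n x
    using that d by (auto simp: T_def datum_code_in_data_codes split: if_splits)
  moreover have "T (Suc (2 * x)) = Datum x" if "x \<in> L" for x
    using that by (simp add: T_def)
  ultimately have "text_for T L"
    unfolding text_for_def content_def by (auto simp: image_iff) metis+
  with learns obtain n0 where n0:
    "\<And>n. n \<ge> n0 \<Longrightarrow> \<exists>e. Td h T n = Some (Hyp e) \<and> C_index \<phi> e \<and> C_set \<phi> e = L"
    unfolding TxtTd_learns_def Bc_C_def text_for_def by metis
  \<comment> \<open>The hypothesis lags one position behind the datum: at
    \<open>Suc (2 * n0)\<close> it is \<open>h d\<close>, unless \<open>h d\<close> is
    \<open>Some NoHyp\<close>.\<close>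
  have "T (2 * n0) = d" by (simp add: T_def)
  then show ?thesis using n0[of "Suc (2 * n0)"] by (auto split: if_splits)
qed

lemma Td_NoHyp:
  "(\<And>i. h (T i) = Some NoHyp) \<Longrightarrow> Td h T n = Some NoHyp"
  by (induction n) simp_all

text \<open>Otherwise \<open>Td\<close> would keep its initial value \<open>NoHyp\<close>
  forever.\<close>

lemma Bc_C_learner_guesses:
  assumes "TxtTd_learns (Bc_C \<phi>) h L" and "text_for T L"
  obtains i where "h (T i) \<noteq> Some NoHyp"
  using assms Td_NoHyp[of h T] by (fastforce simp: TxtTd_learns_def Bc_C_def)

text \<open>From \<open>Suc i\<close> on nothing changes: \<open>NoHyp\<close> keeps the hypothesis
  and any guess repeats \<open>e\<close>.\<close>

lemma Ex_C_if_single_guess: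
  assumes "h (T i) = Some (Hyp e)"
    and "\<And>j. h (T j) = Some NoHyp \<or> h (T j) = Some (Hyp e)"
    and "C_index \<phi> e" "C_set \<phi> e = content T"
  shows "Ex_C \<phi> (Td h T) T"
proof -
  have "Td h T n = Some (Hyp e)" if "n \<ge> Suc i" for n
    using that
  proof (induction n rule: dec_induct)
    case base
    then show ?case using assms(1) by simp
  next
    case (step n)
    then show ?case using assms(2)[of n] by auto
  qed
  then show ?thesis
    using assms(3,4) unfolding Ex_C_def by (metis order_refl)
qed

lemma Ex_C_imp_Bc_C: "Ex_C \<phi> p T \<Longrightarrow> Bc_C \<phi> p T"
  unfolding Ex_C_def Bc_C_def by metis

text \<open>\<open>h'\<close> is chosen before \<open>L\<close>, so it serves a whole class at
  once.\<close>

lemma Ex_C_learner_of_Bc_C_learner: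
  assumes "partial_computable2 \<phi>" and "learner h"
  obtains h' where "learner h'"
    "\<And>L. TxtTd_learns (Bc_C \<phi>) h L \<Longrightarrow> TxtTd_learns (Ex_C \<phi>) h' L"
proof -
  obtain U where U: "\<And>e x. \<phi> e x = eval U [e, x]"
    using assms(1) by (auto simp: partial_computable2_def)
  obtain F where F: "\<And>d. h d = map_option hyp_decode (eval F [datum_code d])"
    using assms(2) by (auto simp: learner_iff_rec_term)
  define h' where "h' d = map_option hyp_decode (eval (First_guess_term U F) [datum_code d])" for d
  have "learner h'"
    by (auto simp: learner_iff_rec_term h'_def)
  moreover have "TxtTd_learns (Ex_C \<phi>) h' L" if learns: "TxtTd_learns (Bc_C \<phi>) h L" for L
    unfolding TxtTd_learns_def
  proof (intro allI impI)
    fix T assume T: "text_for T L"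
    \<comment> \<open>In particular \<open>F\<close> is defined on all codes in
      \<open>data_codes L\<close>, so the search cannot get stuck there.\<close>
    have F_cases: "eval F [k] = Some 0 \<or>
        (\<exists>e. eval F [k] = Some (Suc e) \<and> C_index \<phi> e \<and> C_set \<phi> e = L)"
      if "k \<in> data_codes L" for k
    proof -
      obtain d where "k = datum_code d" "datum_code d \<in> data_codes L"
        using data_codes_cases \<open>k \<in> data_codes L\<close> by blast
      then show ?thesis
        using Bc_C_learner_on_data[OF learns, of d]
        by (auto simp: F)
    qed
    define guess where "guess k \<longleftrightarrow> k \<in> data_codes L \<and> eval F [k] \<noteq> Some 0" for k
    obtain i where "h (T i) \<noteq> Some NoHyp"
      using Bc_C_learner_guesses[OF learns T] .
    then have i: "guess (datum_code (T i))"
      using datum_code_text_in_data_codes[OF T] by (auto simp: guess_def F)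
    \<comment> \<open>The minimum is over \<open>data_codes L\<close>, not over the data in
      \<open>T\<close>: it may be the code of a pause that \<open>T\<close> lacks, and
      \<open>v\<close> is correct for \<open>L\<close> all the same.\<close>
    define m where "m = (LEAST k. guess k)"
    have "guess m" unfolding m_def using i by (rule LeastI)
    then obtain v where m: "m \<in> data_codes L" "eval F [m] = Some (Suc v)"
      and v: "C_index \<phi> v" "C_set \<phi> v = L"
      using F_cases unfolding guess_def by metis
    have least: "eval F [y] = Some 0" if "y < m" "y \<in> data_codes L" for y
      using that not_less_Least[of y guess] by (auto simp: guess_def m_def)
    have h'_T: "h' (T j) = (if guess (datum_code (T j)) then Some (Hyp v) else Some NoHyp)" for j
    proof (cases "guess (datum_code (T j))")
      case True
      then obtain e where "eval F [datum_code (T j)] = Some (Suc e)" "C_index \<phi> e" "C_set \<phi> e = L"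
        using F_cases unfolding guess_def by metis
      then have "eval (First_guess_term U F) [datum_code (T j)] = Some (Suc v)"
        using eval_First_guess_term_Suc[OF U, of e F "datum_code (T j)" m v] m least by blast
      then show ?thesis
        using True by (simp add: h'_def)
    next
      case False
      then show ?thesis
        using datum_code_text_in_data_codes[OF T, of j]
        by (simp add: guess_def h'_def eval_First_guess_term_0)
    qed
    show "Ex_C \<phi> (Td h' T) T"
      by (rule Ex_C_if_single_guess[of _ _ i v])
        (use T i v in \<open>auto simp: h'_T text_for_def\<close>)
  qed
  ultimately show thesis using that by blast
qed

theorem theorem18:
  fixes \<phi> :: "nat \<Rightarrow> nat \<Rightarrow> nat option"
  assumes "acceptable_numbering \<phi>"
  shows "TxtTd_REC (Ex_C \<phi>) = TxtTd_REC (Bc_C \<phi>)"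
proof
  show "TxtTd_REC (Ex_C \<phi>) \<subseteq> TxtTd_REC (Bc_C \<phi>)"
    unfolding TxtTd_REC_def TxtTd_learns_def using Ex_C_imp_Bc_C by blast
  have "partial_computable2 \<phi>"
    using assms by (simp add: acceptable_numbering_def)
  then show "TxtTd_REC (Bc_C \<phi>) \<subseteq> TxtTd_REC (Ex_C \<phi>)"
    unfolding TxtTd_REC_def using Ex_C_learner_of_Bc_C_learner by (smt (verit) Collect_mono)
qed

end
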